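(* Let $X$ be a metrizable, separable, locally compact space and let $\mathcal F=\{f_1,\dots,f_m\}$ be an iterated function system on $X$. Then $\mathcal F$ has compact dynamics if and only if it has a compact global trapping region $Q$.
   Context: Fix a metric $d$ on $X$ compatible with its topology. An iterated function system (IFS) on $X$ is a finite collection $\mathcal F=\{f_1,\dots,f_m\}$, $m\ge1$, of continuous maps $X\to X$. $\mathcal I^m$ is the set of all finite words in the letters $1,\dots,m$ (including the empty word $0$); $|I|$ is the length of $I$. For $I=i_1\cdots i_k$, $\Phi^I_{\mathcal F}=f_{i_k}\circ\dots\circ f_{i_1}$, and $\Phi^0_{\mathcal F}=\mathrm{id}_X$. For $A\subset X$, $H_{\mathcal F}(A)=\bigcup_{i=1}^m f_i(A)$. $A$ is forward-invariant if $f_i(A)\subset A$ for every $i$, and $H$-invariant if $H_{\mathcal F}(A)=A$. A set $A$ absorbs $K$ if there is $\tau>0$ with $\Phi^I_{\mathcal F}(K)\subset A$ for every $I$ with $|I|\ge\tau$. Put $N_\varepsilon(A)=\{x: d(x,A)<\varepsilon\}$, where $d(x,A)=\inf_{a\in A}d(x,a)$ and $\inf\emptyset=+\infty$. $A$ attracts $K$ if for every $\varepsilon>0$ there is $\tau>0$ with $\Phi^I_{\mathcal F}(K)\subset N_\varepsilon(A)$ for every $I$ with $|I|\ge\tau$. A global attractor of $\mathcal F$ is a compact $H$-invariant set that attracts every compact subset of $X$. $\mathcal F$ has compact dynamics if it has a global attractor. A trapping region is a closed forward-invariant set $Q\subset X$; it is global if it absorbs every compact subset of $X$. *)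

theory Defs
  imports "HOL-Analysis.Analysis"
begin

text \<open>
  The space is an abstract topology \<open>X\<close> on the points \<open>topspace X\<close> (possibly none), and \<open>d\<close> is a
  metric on \<open>topspace X\<close> that induces \<open>X\<close>. An iterated function system is a family
  \<open>f 1, \<dots>, f m\<close>; the values of the \<open>f i\<close> outside \<open>topspace X\<close> are irrelevant.
\<close>

definition compatible_metric :: "'a topology \<Rightarrow> ('a \<Rightarrow> 'a \<Rightarrow> real) \<Rightarrow> bool" where
  "compatible_metric X d \<longleftrightarrow>
     Metric_space (topspace X) d \<and> Metric_space.mtopology (topspace X) d = X"

definition ifs :: "'a topology \<Rightarrow> nat \<Rightarrow> (nat \<Rightarrow> 'a \<Rightarrow> 'a) \<Rightarrow> bool" where
  "ifs X m f \<longleftrightarrow> m \<ge> 1 \<and> (\<forall>i\<in>{1..m}. continuous_map X X (f i))"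

definition words :: "nat \<Rightarrow> nat list set" where
  "words m = lists {1..m}"

text \<open>
  The first letter of a word acts first:
  \<open>word_map f [i\<^sub>1, \<dots>, i\<^sub>k] = f i\<^sub>k \<circ> \<dots> \<circ> f i\<^sub>1\<close> and \<open>word_map f [] = id\<close>.
\<close>

definition word_map :: "(nat \<Rightarrow> 'a \<Rightarrow> 'a) \<Rightarrow> nat list \<Rightarrow> 'a \<Rightarrow> 'a" where
  "word_map f I = fold f I"

definition hutchinson :: "nat \<Rightarrow> (nat \<Rightarrow> 'a \<Rightarrow> 'a) \<Rightarrow> 'a set \<Rightarrow> 'a set" where
  "hutchinson m f A = (\<Union>i\<in>{1..m}. f i ` A)"

definition forward_invariant :: "nat \<Rightarrow> (nat \<Rightarrow> 'a \<Rightarrow> 'a) \<Rightarrow> 'a set \<Rightarrow> bool" where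
  "forward_invariant m f A \<longleftrightarrow> (\<forall>i\<in>{1..m}. f i ` A \<subseteq> A)"

definition H_invariant :: "nat \<Rightarrow> (nat \<Rightarrow> 'a \<Rightarrow> 'a) \<Rightarrow> 'a set \<Rightarrow> bool" where
  "H_invariant m f A \<longleftrightarrow> hutchinson m f A = A"

definition absorbs :: "nat \<Rightarrow> (nat \<Rightarrow> 'a \<Rightarrow> 'a) \<Rightarrow> 'a set \<Rightarrow> 'a set \<Rightarrow> bool" where
  "absorbs m f A K \<longleftrightarrow>
     (\<exists>\<tau>>0. \<forall>I\<in>words m. length I \<ge> \<tau> \<longrightarrow> word_map f I ` K \<subseteq> A)"

text \<open>
  The infimum is taken in \<^typ>\<open>ereal\<close> so that the distance to the empty set is \<open>\<infinity>\<close>;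
  the real-valued \<^const>\<open>infdist\<close> would give 0 there.
\<close>

definition dist_set :: "('a \<Rightarrow> 'a \<Rightarrow> real) \<Rightarrow> 'a \<Rightarrow> 'a set \<Rightarrow> ereal" where
  "dist_set d x A = (INF a\<in>A. ereal (d x a))"

definition eps_nbhd ::
  "'a topology \<Rightarrow> ('a \<Rightarrow> 'a \<Rightarrow> real) \<Rightarrow> real \<Rightarrow> 'a set \<Rightarrow> 'a set" where
  "eps_nbhd X d \<epsilon> A = {x \<in> topspace X. dist_set d x A < ereal \<epsilon>}"

definition attracts ::
  "'a topology \<Rightarrow> ('a \<Rightarrow> 'a \<Rightarrow> real) \<Rightarrow> nat \<Rightarrow> (nat \<Rightarrow> 'a \<Rightarrow> 'a) \<Rightarrow> 'a set \<Rightarrow> 'a set \<Rightarrow> bool" where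
  "attracts X d m f A K \<longleftrightarrow>
     (\<forall>\<epsilon>>0. \<exists>\<tau>>0. \<forall>I\<in>words m. length I \<ge> \<tau> \<longrightarrow> word_map f I ` K \<subseteq> eps_nbhd X d \<epsilon> A)"

definition global_attractor ::
  "'a topology \<Rightarrow> ('a \<Rightarrow> 'a \<Rightarrow> real) \<Rightarrow> nat \<Rightarrow> (nat \<Rightarrow> 'a \<Rightarrow> 'a) \<Rightarrow> 'a set \<Rightarrow> bool" where
  "global_attractor X d m f A \<longleftrightarrow>
     compactin X A \<and> H_invariant m f A \<and> (\<forall>K. compactin X K \<longrightarrow> attracts X d m f A K)"

definition compact_dynamics ::
  "'a topology \<Rightarrow> ('a \<Rightarrow> 'a \<Rightarrow> real) \<Rightarrow> nat \<Rightarrow> (nat \<Rightarrow> 'a \<Rightarrow> 'a) \<Rightarrow> bool" where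
  "compact_dynamics X d m f \<longleftrightarrow> (\<exists>A. global_attractor X d m f A)"

definition trapping_region :: "'a topology \<Rightarrow> nat \<Rightarrow> (nat \<Rightarrow> 'a \<Rightarrow> 'a) \<Rightarrow> 'a set \<Rightarrow> bool" where
  "trapping_region X m f Q \<longleftrightarrow> closedin X Q \<and> forward_invariant m f Q"

definition global_trapping_region ::
  "'a topology \<Rightarrow> nat \<Rightarrow> (nat \<Rightarrow> 'a \<Rightarrow> 'a) \<Rightarrow> 'a set \<Rightarrow> bool" where
  "global_trapping_region X m f Q \<longleftrightarrow>
     trapping_region X m f Q \<and> (\<forall>K. compactin X K \<longrightarrow> absorbs m f Q K)"

end

theory Submission
  imports Defs
begin

text \<open>
  If \<open>A\<close> is a global attractor, take a compact neighbourhood \<open>K\<close> of \<open>A\<close>. All words of length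
  at least some \<open>\<tau>\<close> map \<open>K\<close> into itself, so the union of the images of \<open>K\<close> under the finitely many
  words of length at most \<open>\<tau>\<close> is compact and forward-invariant; it absorbs every compact set because
  \<open>K\<close> already does. Conversely, if \<open>Q\<close> is a compact global trapping region, the iterates of \<open>Q\<close> under
  the Hutchinson operator form a decreasing sequence of compact sets, and their intersection is a
  global attractor.
\<close>

section \<open>Compact sets and metric neighbourhoods\<close>

text \<open>Otherwise the sets \<open>C n - U\<close> would be nonempty, decreasing and closed in
  the compact \<open>C 0\<close>, so they would share a point, lying in the intersection but outside
  \<open>U\<close>.\<close>

lemma nested_compactin_subset_open:
  fixes C :: "nat \<Rightarrow> 'a set"
  assumes "Hausdorff_space X" and comp: "\<And>n. compactin X (C n)" and "decseq C"
    and "openin X U" and sub: "(\<Inter>n. C n) \<subseteq> U"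
  shows "\<exists>n. C n \<subseteq> U"
proof (rule ccontr)
  assume "\<nexists>n. C n \<subseteq> U"
  then have ne: "C n - U \<noteq> {}" for n
    by blast
  have sub0: "C n \<subseteq> C 0" for n
    using \<open>decseq C\<close> by (simp add: decseqD)
  have "closedin (subtopology X (C 0)) (C n - U)" for n
  proof -
    have "closedin X (C n - U)"
      using assms by (simp add: closedin_diff compactin_imp_closedin)
    then show ?thesis
      using sub0 by (meson Diff_subset closedin_subset_topspace subset_trans)
  qed
  moreover have "compact_space (subtopology X (C 0))"
    using comp by (simp add: compact_space_subtopology)
  moreover have "decseq (\<lambda>n. C n - U)"
    using \<open>decseq C\<close> unfolding decseq_def by blast
  ultimately have "(\<Inter>n. C n - U) \<noteq> {}"
    using compact_space_imp_nest[of "subtopology X (C 0)" "\<lambda>n. C n - U"] ne by blast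
  then show False
    using sub by blast
qed

text \<open>An infimum is below a bound exactly when some member is; for empty \<open>A\<close> the
  infimum is \<infinity> and both sides are empty.\<close>

lemma eps_nbhd_eq_Union_mball:
  assumes "compatible_metric X d" and "A \<subseteq> topspace X"
  shows "eps_nbhd X d \<epsilon> A = (\<Union>a\<in>A. Metric_space.mball (topspace X) d a \<epsilon>)"
proof -
  interpret Metric_space "topspace X" d
    using assms(1) by (simp add: compatible_metric_def)
  show ?thesis
    using assms(2) by (auto simp: eps_nbhd_def dist_set_def INF_less_iff commute subset_iff)
qed

lemma openin_eps_nbhd:
  assumes "compatible_metric X d" and "A \<subseteq> topspace X"
  shows "openin X (eps_nbhd X d \<epsilon> A)"
proof -
  interpret Metric_space "topspace X" d
    using assms(1) by (simp add: compatible_metric_def)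
  have "mtopology = X"
    using assms(1) by (simp add: compatible_metric_def)
  then show ?thesis
    unfolding eps_nbhd_eq_Union_mball[OF assms] using openin_mball by (intro openin_Union) auto
qed

lemma subset_eps_nbhd:
  assumes "compatible_metric X d" and "A \<subseteq> topspace X" and "\<epsilon> > 0"
  shows "A \<subseteq> eps_nbhd X d \<epsilon> A"
proof -
  interpret Metric_space "topspace X" d
    using assms(1) by (simp add: compatible_metric_def)
  show ?thesis
    unfolding eps_nbhd_eq_Union_mball[OF assms(1,2)] using assms(2,3) by auto
qed

text \<open>This turns attraction by \<open>A\<close> into absorption by the compact set
  \<open>K\<close>.\<close>

lemma compact_neighbourhood_contains_eps_nbhd:
  assumes X: "locally_compact_space X" and d: "compatible_metric X d" and A: "compactin X A"
  obtains K \<epsilon> where "compactin X K" and "\<epsilon> > 0" and "eps_nbhd X d \<epsilon> A \<subseteq> K"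
proof -
  interpret Metric_space "topspace X" d
    using d by (simp add: compatible_metric_def)
  have top: "mtopology = X"
    using d by (simp add: compatible_metric_def)
  then have "Hausdorff_space X"
    using Hausdorff_space_mtopology by simp
  then obtain U K where UK: "openin X U" "compactin X K" "A \<subseteq> U" "U \<subseteq> K"
    using X A by (meson locally_compact_space_compact_closed_compact)
  \<comment> \<open>A Lebesgue number for the cover of the compact set \<open>A\<close> by the
    single set \<open>U\<close> gives one radius for all points of \<open>A\<close>.\<close>
  obtain \<epsilon> where "\<epsilon> > 0" and \<epsilon>: "\<forall>x\<in>A. mball x \<epsilon> \<subseteq> U"
    using lebesgue_number[of A "{U}"] A UK top by auto
  then have "eps_nbhd X d \<epsilon> A \<subseteq> U"
    unfolding eps_nbhd_eq_Union_mball[OF d compactin_subset_topspace[OF A]] by blast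
  then show thesis
    using that UK \<open>\<epsilon> > 0\<close> by blast
qed

section \<open>Word maps and iterates of the Hutchinson operator\<close>

lemma word_map_append: "word_map f (I @ J) ` S = word_map f J ` word_map f I ` S"
  by (auto simp: word_map_def image_comp)

lemma continuous_map_word_map:
  assumes "ifs X m f" and "I \<in> words m"
  shows "continuous_map X X (word_map f I)"
  using assms(2)
proof (induction I rule: rev_induct)
  case Nil
  then show ?case by (simp add: word_map_def id_def flip: continuous_map_id)
next
  case (snoc i I)
  then have "i \<in> {1..m}" and "continuous_map X X (word_map f I)"
    by (auto simp: words_def)
  moreover have "word_map f (I @ [i]) = f i \<circ> word_map f I"
    by (simp add: word_map_def)
  ultimately show ?case
    using assms(1) by (metis continuous_map_compose ifs_def)
qed

lemma compactin_hutchinson: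
  assumes "ifs X m f" and "compactin X S"
  shows "compactin X (hutchinson m f S)"
  unfolding hutchinson_def using assms
  by (intro compactin_Union) (auto simp: ifs_def intro: image_compactin)

lemma hutchinson_mono: "S \<subseteq> T \<Longrightarrow> hutchinson m f S \<subseteq> hutchinson m f T"
  unfolding hutchinson_def by blast

text \<open>The induction peels letters off the right: the last letter acts last and so matches the
  outermost \<open>hutchinson\<close>.\<close>

lemma word_map_subset_hutchinson:
  assumes "I \<in> words m"
  shows "word_map f I ` S \<subseteq> (hutchinson m f ^^ length I) S"
  using assms
proof (induction I rule: rev_induct)
  case Nil
  then show ?case by (simp add: word_map_def)
next
  case (snoc i I)
  then have i: "i \<in> {1..m}" and IH: "word_map f I ` S \<subseteq> (hutchinson m f ^^ length I) S"
    by (auto simp: words_def)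
  have "word_map f (I @ [i]) ` S = f i ` word_map f I ` S"
    by (simp add: word_map_def image_comp)
  also have "\<dots> \<subseteq> f i ` (hutchinson m f ^^ length I) S"
    using IH by (rule image_mono)
  also have "\<dots> \<subseteq> hutchinson m f ((hutchinson m f ^^ length I) S)"
    using i unfolding hutchinson_def by blast
  finally show ?case
    by simp
qed

lemma decseq_hutchinson_funpow:
  assumes "forward_invariant m f Q"
  shows "decseq (\<lambda>n. (hutchinson m f ^^ n) Q)"
proof (rule decseq_SucI)
  fix n
  show "(hutchinson m f ^^ Suc n) Q \<subseteq> (hutchinson m f ^^ n) Q"
  proof (induction n)
    case 0
    then show ?case
      using assms by (auto simp: hutchinson_def forward_invariant_def)
  next
    case (Suc n)
    then show ?case
      using hutchinson_mono by fastforce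
  qed
qed

section \<open>From a compact trapping region to an attractor\<close>

text \<open>Images need not commute with intersections, so monotonicity yields only one inclusion;
  the other rests on compactness of the iterates.\<close>

lemma H_invariant_Inter_hutchinson_funpow:
  assumes "Hausdorff_space X" and ifs: "ifs X m f"
    and Q: "compactin X Q" and "forward_invariant m f Q"
  shows "H_invariant m f (\<Inter>n. (hutchinson m f ^^ n) Q)"
proof -
  define C where "C n = (hutchinson m f ^^ n) Q" for n
  have comp: "compactin X (C n)" for n
    unfolding C_def using Q by (induction n) (auto intro: compactin_hutchinson[OF ifs])
  have dec: "decseq C"
    unfolding C_def using decseq_hutchinson_funpow assms(4) .
  have Suc: "C (Suc n) = hutchinson m f (C n)" for n
    by (simp add: C_def)
  have "hutchinson m f (\<Inter>n. C n) = (\<Inter>n. C n)"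
  proof
    have "hutchinson m f (\<Inter>n. C n) \<subseteq> C (Suc n)" for n
      unfolding Suc by (intro hutchinson_mono) auto
    moreover have "C (Suc n) \<subseteq> C n" for n
      using dec by (rule decseq_SucD)
    ultimately show "hutchinson m f (\<Inter>n. C n) \<subseteq> (\<Inter>n. C n)"
      by blast
  next
    show "(\<Inter>n. C n) \<subseteq> hutchinson m f (\<Inter>n. C n)"
    proof
      fix a assume a: "a \<in> (\<Inter>n. C n)"
      have "a \<in> topspace X"
        using a compactin_subset_topspace[OF comp[of 0]] by blast
      then have closed: "closedin X {a}"
        using assms(1) by (simp add: compactin_imp_closedin)
      \<comment> \<open>Cut down to \<open>topspace X\<close>, the preimages of \<open>a\<close> are
        closed by continuity of \<open>f i\<close>, whose values elsewhere are arbitrary.\<close>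
      define P where "P i = {x \<in> topspace X. f i x = a}" for i
      have P: "closedin X (P i)" if "i \<in> {1..m}" for i
        using closedin_continuous_map_preimage[OF _ closed, of X "f i"] that ifs
        by (simp add: P_def ifs_def)
      text \<open>If \<open>a\<close> had no preimage in the intersection, then by compactness some \<open>C n\<close> would miss all
        preimages of \<open>a\<close>, contradicting \<open>a \<in> C (Suc n)\<close>.\<close>
      show "a \<in> hutchinson m f (\<Inter>n. C n)"
      proof (rule ccontr)
        assume not: "a \<notin> hutchinson m f (\<Inter>n. C n)"
        let ?U = "topspace X - (\<Union>i\<in>{1..m}. P i)"
        have "openin X ?U"
          using P by (intro openin_diff closedin_Union) auto
        moreover have "(\<Inter>n. C n) \<subseteq> ?U"
          using not compactin_subset_topspace[OF comp[of 0]]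
          unfolding P_def hutchinson_def by blast
        ultimately obtain n where n: "C n \<subseteq> ?U"
          using nested_compactin_subset_open[OF assms(1) comp dec] by blast
        have "a \<in> hutchinson m f (C n)"
          using a Suc by blast
        then show False
          using n by (auto simp: hutchinson_def P_def)
      qed
    qed
  qed
  then show ?thesis
    by (simp add: H_invariant_def C_def)
qed

lemma global_attractor_Inter_hutchinson_funpow:
  assumes d: "compatible_metric X d" and ifs: "ifs X m f"
    and Q: "compactin X Q" and "global_trapping_region X m f Q"
  shows "global_attractor X d m f (\<Inter>n. (hutchinson m f ^^ n) Q)"
proof -
  have "Hausdorff_space X"
    using d Metric_space.Hausdorff_space_mtopology unfolding compatible_metric_def by metis
  define C where "C n = (hutchinson m f ^^ n) Q" for n
  define A where "A = (\<Inter>n. C n)"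
  have fwd: "forward_invariant m f Q" and absorb: "compactin X K \<Longrightarrow> absorbs m f Q K" for K
    using assms(4) by (auto simp: global_trapping_region_def trapping_region_def)
  have comp: "compactin X (C n)" for n
    unfolding C_def using Q by (induction n) (auto intro: compactin_hutchinson[OF ifs])
  have dec: "decseq C"
    unfolding C_def using decseq_hutchinson_funpow fwd .
  have A: "compactin X A"
    unfolding A_def using comp \<open>Hausdorff_space X\<close>
    by (intro closed_compactin[OF comp[of 0]] closedin_Inter) (auto intro: compactin_imp_closedin)
  have "attracts X d m f A K" if "compactin X K" for K
    unfolding attracts_def
  proof (intro allI impI)
    fix \<epsilon> :: real assume "\<epsilon> > 0"
    \<comment> \<open>The neighbourhood is open and contains the whole intersection, so by
      compactness it already contains some iterate.\<close>
    obtain n where n: "C n \<subseteq> eps_nbhd X d \<epsilon> A"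
      using nested_compactin_subset_open[OF \<open>Hausdorff_space X\<close> comp dec openin_eps_nbhd[OF d]]
        subset_eps_nbhd[OF d _ \<open>\<epsilon> > 0\<close>] compactin_subset_topspace[OF A] A_def by metis
    obtain \<tau> where "\<tau> > 0"
      and \<tau>: "\<And>I. I \<in> words m \<Longrightarrow> length I \<ge> \<tau> \<Longrightarrow> word_map f I ` K \<subseteq> Q"
      using absorb[OF \<open>compactin X K\<close>] by (auto simp: absorbs_def)
    \<comment> \<open>The first \<tau> letters bring \<open>K\<close> into \<open>Q\<close>; the
      remaining letters, at least \<open>n\<close> of them, bring \<open>Q\<close> into
      \<open>C n\<close>.\<close>
    have "word_map f I ` K \<subseteq> eps_nbhd X d \<epsilon> A" if I: "I \<in> words m" "length I \<ge> \<tau> + n" for I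
    proof -
      have words: "take \<tau> I \<in> words m" "drop \<tau> I \<in> words m"
        using I by (auto simp: words_def dest: in_set_takeD in_set_dropD)
      have "word_map f I ` K = word_map f (drop \<tau> I) ` word_map f (take \<tau> I) ` K"
        by (metis append_take_drop_id word_map_append)
      also have "\<dots> \<subseteq> word_map f (drop \<tau> I) ` Q"
        using \<tau>[OF words(1)] I by (intro image_mono) auto
      also have "\<dots> \<subseteq> C (length I - \<tau>)"
        using word_map_subset_hutchinson[OF words(2)] by (simp add: C_def)
      also have "\<dots> \<subseteq> C n"
        using dec I by (simp add: decseqD)
      finally show ?thesis
        using n by blast
    qed
    then show "\<exists>\<tau>>0. \<forall>I\<in>words m. \<tau> \<le> length I \<longrightarrow> word_map f I ` K \<subseteq> eps_nbhd X d \<epsilon> A"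
      using \<open>\<tau> > 0\<close> by (intro exI[of _ "\<tau> + n"]) auto
  qed
  then show ?thesis
    using A H_invariant_Inter_hutchinson_funpow[OF \<open>Hausdorff_space X\<close> ifs Q fwd]
    by (simp add: global_attractor_def A_def C_def)
qed

section \<open>From an attractor to a compact trapping region\<close>

lemma global_attractor_imp_compact_global_trapping_region:
  assumes X: "locally_compact_space X" and d: "compatible_metric X d" and ifs: "ifs X m f"
    and A: "global_attractor X d m f A"
  obtains Q where "compactin X Q" and "global_trapping_region X m f Q"
proof -
  have "Hausdorff_space X"
    using d Metric_space.Hausdorff_space_mtopology unfolding compatible_metric_def by metis
  obtain K \<epsilon> where K: "compactin X K" and "\<epsilon> > 0" and nbhd: "eps_nbhd X d \<epsilon> A \<subseteq> K"
    using compact_neighbourhood_contains_eps_nbhd[OF X d] A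
    by (metis global_attractor_def)
  \<comment> \<open>Attraction at the single radius \<epsilon> is enough. Taking \<open>L\<close> to
    be \<open>K\<close> itself then yields the return time \<tau>.\<close>
  have absorb: "\<exists>\<tau>>0. \<forall>I\<in>words m. \<tau> \<le> length I \<longrightarrow> word_map f I ` L \<subseteq> K" if "compactin X L" for L
    using A \<open>\<epsilon> > 0\<close> nbhd that unfolding global_attractor_def attracts_def
    by (meson subset_trans)
  then obtain \<tau> where \<tau>: "\<And>I. I \<in> words m \<Longrightarrow> \<tau> \<le> length I \<Longrightarrow> word_map f I ` K \<subseteq> K"
    using K by blast
  \<comment> \<open>Finiteness of \<open>W\<close> makes \<open>Q\<close> compact, and the empty
    word in \<open>W\<close> puts \<open>K\<close> inside \<open>Q\<close>.\<close>
  define W where "W = {I \<in> words m. length I \<le> \<tau>}"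
  define Q where "Q = (\<Union>I\<in>W. word_map f I ` K)"
  have "finite W"
    using finite_lists_length_le[of "{1..m}" \<tau>] by (simp add: W_def words_def lists_eq_set)
  then have Q: "compactin X Q"
    unfolding Q_def using ifs K
    by (intro compactin_Union) (auto simp: W_def intro: image_compactin continuous_map_word_map)
  have KQ: "K \<subseteq> Q"
  proof -
    have "[] \<in> W"
      by (simp add: W_def words_def)
    then show ?thesis
      by (force simp: Q_def word_map_def)
  qed
  have "f i ` word_map f I ` K \<subseteq> Q" if "i \<in> {1..m}" "I \<in> W" for i I
  proof -
    have eq: "f i ` word_map f I ` K = word_map f (I @ [i]) ` K"
      by (simp add: word_map_append) (simp add: word_map_def)
    have word: "I @ [i] \<in> words m"
      using that by (auto simp: W_def words_def)
    \<comment> \<open>Appending a letter stays in \<open>W\<close> unless the length is already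
      \<tau>; in that case the longer word maps \<open>K\<close> back into \<open>K\<close>.\<close>
    show ?thesis
    proof (cases "length I < \<tau>")
      case True
      then have "I @ [i] \<in> W"
        using word by (simp add: W_def)
      then show ?thesis
        unfolding eq Q_def by blast
    next
      case False
      then have "word_map f (I @ [i]) ` K \<subseteq> K"
        by (intro \<tau> word) simp
      then show ?thesis
        unfolding eq using KQ by blast
    qed
  qed
  then have "(\<Union>I\<in>W. f i ` word_map f I ` K) \<subseteq> Q" if "i \<in> {1..m}" for i
    by (rule UN_least) (rule that)
  then have "forward_invariant m f Q"
    by (simp add: forward_invariant_def Q_def image_UN)
  moreover have "absorbs m f Q L" if "compactin X L" for L
    unfolding absorbs_def using absorb[OF that] KQ by (meson subset_trans)
  ultimately have "global_trapping_region X m f Q"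
    using Q \<open>Hausdorff_space X\<close>
    by (simp add: global_trapping_region_def trapping_region_def compactin_imp_closedin)
  then show thesis
    using that Q by blast
qed

theorem theorem2:
  fixes X :: "'a topology" and d :: "'a \<Rightarrow> 'a \<Rightarrow> real"
    and m :: nat and f :: "nat \<Rightarrow> 'a \<Rightarrow> 'a"
  assumes "metrizable_space X" and "separable_space X" and "locally_compact_space X"
    and "compatible_metric X d"
    and "ifs X m f"
  shows "compact_dynamics X d m f \<longleftrightarrow> (\<exists>Q. compactin X Q \<and> global_trapping_region X m f Q)"
proof
  assume "compact_dynamics X d m f"
  then show "\<exists>Q. compactin X Q \<and> global_trapping_region X m f Q"
    using global_attractor_imp_compact_global_trapping_region[OF assms(3-5)]
    by (auto simp: compact_dynamics_def)
next
  assume "\<exists>Q. compactin X Q \<and> global_trapping_region X m f Q"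
  then show "compact_dynamics X d m f"
    using global_attractor_Inter_hutchinson_funpow[OF assms(4,5)]
    by (auto simp: compact_dynamics_def)
qed

end
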